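(* Let $C=(c_{ij})$ be an $n\times n$ nonnegative matrix. Let $m$ be the sum of the entries of $C$, and let $d$ (resp. $f$) be any number which is larger than or equal to the largest diagonal element (resp. the largest off-diagonal element) of $C$. Then $$\rho(C)\le \frac{d-f+\sqrt{(d-f)^2+4mf}}{2}.$$ Moreover, if $mf>0$, then equality holds if and only if $m=k(k-1)f+kd$ and $$PCP^T=\begin{pmatrix} fJ_k+(d-f)I_k & 0\\ 0 & O_{n-k}\end{pmatrix}$$ for some $n\times n$ permutation matrix $P$ and some nonnegative integer $k$.
   Context: All matrices are real. $\rho(C)$ denotes the spectral radius of $C$, i.e. the maximum modulus of its (complex) eigenvalues. $J_k$, $I_k$, $O_k$ denote the $k\times k$ all-one, identity, and zero matrices. *)

theory Defs
  imports
    "Jordan_Normal_Form.Spectral_Radius"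
    "HOL-Combinatorics.Permutations"
begin

text \<open>The library's spectral radius is that of a complex matrix; for a real matrix, all
  complex eigenvalues have to be taken into account.\<close>

definition real_spectral_radius :: "real mat \<Rightarrow> real" where
  "real_spectral_radius C = spectral_radius (map_mat complex_of_real C)"

definition all_ones_mat :: "nat \<Rightarrow> real mat" where
  "all_ones_mat k = mat k k (\<lambda>_. 1)"

definition permutation_matrix :: "nat \<Rightarrow> real mat \<Rightarrow> bool" where
  "permutation_matrix n P \<longleftrightarrow>
    (\<exists>p. p permutes {..<n} \<and> P = mat n n (\<lambda>(i, j). if j = p i then 1 else 0))"

end

theory Submission
  imports Defs
begin

text \<open>Take a complex eigenvector for an eigenvalue of maximal modulus \<open>r\<close>, and let \<open>x\<close> consist of the
  moduli of its entries, scaled so that the largest one is \<open>x s = 1\<close>. Then \<open>r * x i \<le> (C x) i\<close>, and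
  expanding \<open>r\<^sup>2 = r * (r * x s)\<close> along row \<open>s\<close> writes \<open>(d - f) * r + f * m - r\<^sup>2\<close> as a sum of
  nonnegative terms. If all of these vanish, then \<open>x\<close> is the indicator of a set \<open>S\<close> of indices, and
  \<open>C\<close> is \<open>d\<close> on the diagonal of \<open>S \<times> S\<close>, \<open>f\<close> elsewhere on \<open>S \<times> S\<close>, and \<open>0\<close> outside.\<close>

section \<open>Quadratic inequality for subinvariant vectors, and its equality case\<close>

text \<open>Starting from \<open>r * (r * x s)\<close>, five replacements lead to
  \<open>(d - f) * r + f * m\<close>, where \<open>m\<close> is the double sum of \<open>c\<close>:
  \<open>r * x s\<close> by row \<open>s\<close> of \<open>C x\<close>, \<open>c s s\<close> by
  \<open>d\<close>, the other \<open>c s j\<close> by \<open>f\<close>, the vector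
  \<open>r x\<close> by \<open>C x\<close> inside the total, and \<open>x j\<close> by 1 in that
  total. Each term on the right is the error of one replacement. This is pure ring algebra; signs
  enter only later.\<close>

lemma slack_identity:
  fixes c :: "'i \<Rightarrow> 'i \<Rightarrow> 'a :: comm_ring_1"
  assumes "finite I" "s \<in> I" "x s = 1"
  shows "(d - f) * r + f * (\<Sum>i\<in>I. \<Sum>j\<in>I. c i j) - r\<^sup>2 =
    (d - c s s) * r + (\<Sum>j\<in>I - {s}. (f - c s j) * (r * x j))
    + f * (\<Sum>i\<in>I. \<Sum>j\<in>I. c i j * (1 - x j))
    + f * (\<Sum>i\<in>I. (\<Sum>j\<in>I. c i j * x j) - r * x i)
    + r * ((\<Sum>j\<in>I. c s j * x j) - r * x s)"
proof -
  have off: "(\<Sum>j\<in>I - {s}. (f - c s j) * (r * x j)) =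
      f * r * (\<Sum>j\<in>I - {s}. x j) - r * (\<Sum>j\<in>I - {s}. c s j * x j)"
    by (simp add: sum_distrib_left flip: sum_subtractf) (simp add: algebra_simps)
  have all: "(\<Sum>i\<in>I. \<Sum>j\<in>I. c i j * (1 - x j)) =
      (\<Sum>i\<in>I. \<Sum>j\<in>I. c i j) - (\<Sum>i\<in>I. \<Sum>j\<in>I. c i j * x j)"
    by (simp add: sum_subtractf right_diff_distrib)
  \<comment> \<open>With \<open>x s = 1\<close> split off, the remaining sum over
    \<open>I - {s}\<close> cancels against the one in \<open>off\<close>; the leftover 1 is the
    source of \<open>- f * r\<close>.\<close>
  have err: "(\<Sum>i\<in>I. (\<Sum>j\<in>I. c i j * x j) - r * x i) =
      (\<Sum>i\<in>I. \<Sum>j\<in>I. c i j * x j) - r * (1 + (\<Sum>j\<in>I - {s}. x j))"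
    using sum.remove[OF assms(1,2), of x] assms(3) by (simp add: sum_subtractf flip: sum_distrib_left)
  have row: "(\<Sum>j\<in>I. c s j * x j) = c s s + (\<Sum>j\<in>I - {s}. c s j * x j)"
    using assms by (simp add: sum.remove[of I s])
  show ?thesis
    unfolding off all err row using assms(3) by (simp add: algebra_simps power2_eq_square)
qed

text \<open>The hypotheses make every error term of \<open>slack_identity\<close> nonnegative, so
  equality forces all five to vanish. The diagonal value and the alternative
  \<open>c s j = f\<close> concern row \<open>s\<close> only, which is why \<open>s\<close> is kept
  as an arbitrary index with \<open>x s = 1\<close>.\<close>

lemma subinvariant_quadratic_bound:
  fixes c :: "'i \<Rightarrow> 'i \<Rightarrow> real"
  assumes fin: "finite I" and s: "s \<in> I" "x s = 1"
    and c0: "\<And>i j. i \<in> I \<Longrightarrow> j \<in> I \<Longrightarrow> 0 \<le> c i j"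
    and cd: "\<And>i. i \<in> I \<Longrightarrow> c i i \<le> d"
    and cf: "\<And>i j. i \<in> I \<Longrightarrow> j \<in> I \<Longrightarrow> i \<noteq> j \<Longrightarrow> c i j \<le> f"
    and x: "\<And>i. i \<in> I \<Longrightarrow> 0 \<le> x i" "\<And>i. i \<in> I \<Longrightarrow> x i \<le> 1"
    and sub: "\<And>i. i \<in> I \<Longrightarrow> r * x i \<le> (\<Sum>j\<in>I. c i j * x j)"
    and "0 \<le> f" "0 \<le> r"
  shows "r\<^sup>2 \<le> (d - f) * r + f * (\<Sum>i\<in>I. \<Sum>j\<in>I. c i j)" (is ?le)
    and "r\<^sup>2 = (d - f) * r + f * (\<Sum>i\<in>I. \<Sum>j\<in>I. c i j) \<Longrightarrow> 0 < f \<Longrightarrow> 0 < r \<Longrightarrow>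
      c s s = d \<and> (\<forall>j\<in>I - {s}. c s j = f \<or> x j = 0) \<and>
      (\<forall>i\<in>I. \<forall>j\<in>I. c i j = 0 \<or> x j = 1) \<and>
      (\<forall>i\<in>I. r * x i = (\<Sum>j\<in>I. c i j * x j))" (is "?eq \<Longrightarrow> _ \<Longrightarrow> _ \<Longrightarrow> ?A \<and> ?B \<and> ?C \<and> ?D")
proof -
  have n1: "0 \<le> (d - c s s) * r"
    using cd[OF s(1)] \<open>0 \<le> r\<close> by simp
  have t2: "0 \<le> (f - c s j) * (r * x j)" if "j \<in> I - {s}" for j
    using that cf[OF s(1), of j] x(1)[of j] \<open>0 \<le> r\<close> by auto
  then have n2: "0 \<le> (\<Sum>j\<in>I - {s}. (f - c s j) * (r * x j))"
    by (rule sum_nonneg)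
  have t3: "0 \<le> c i j * (1 - x j)" if "i \<in> I" "j \<in> I" for i j
    using c0[OF that] x(2)[OF that(2)] by simp
  then have n3: "0 \<le> f * (\<Sum>i\<in>I. \<Sum>j\<in>I. c i j * (1 - x j))"
    using \<open>0 \<le> f\<close> by (simp add: sum_nonneg)
  have t4: "0 \<le> (\<Sum>j\<in>I. c i j * x j) - r * x i" if "i \<in> I" for i
    using sub[OF that] by simp
  then have n4: "0 \<le> f * (\<Sum>i\<in>I. (\<Sum>j\<in>I. c i j * x j) - r * x i)"
    using \<open>0 \<le> f\<close> by (intro mult_nonneg_nonneg sum_nonneg) auto
  have n5: "0 \<le> r * ((\<Sum>j\<in>I. c s j * x j) - r * x s)"
    using t4[OF s(1)] \<open>0 \<le> r\<close> by simp
  note slack = slack_identity[where d = d and f = f and c = c and r = r and x = x, OF fin s]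
  show ?le
    using slack n1 n2 n3 n4 n5 by linarith
  assume ?eq and pos: "0 < f" "0 < r"
  then have z: "(d - c s s) * r = 0" "(\<Sum>j\<in>I - {s}. (f - c s j) * (r * x j)) = 0"
    "f * (\<Sum>i\<in>I. \<Sum>j\<in>I. c i j * (1 - x j)) = 0"
    "f * (\<Sum>i\<in>I. (\<Sum>j\<in>I. c i j * x j) - r * x i) = 0"
    using slack n1 n2 n3 n4 n5 by linarith+
  have ?A using z(1) pos by simp
  moreover have ?B
  proof
    fix j assume j: "j \<in> I - {s}"
    have "(f - c s j) * (r * x j) = 0"
      using sum_nonneg_0[OF _ t2 z(2) j] fin by simp
    then show "c s j = f \<or> x j = 0" using pos by auto
  qed
  moreover have ?C
  proof (intro ballI)
    fix i j assume ij: "i \<in> I" "j \<in> I"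
    have "(\<Sum>i\<in>I. \<Sum>j\<in>I. c i j * (1 - x j)) = 0" using z(3) pos by simp
    then have "(\<Sum>j\<in>I. c i j * (1 - x j)) = 0"
      using ij fin t3 by (subst (asm) sum_nonneg_eq_0_iff) (auto intro!: sum_nonneg)
    then have "c i j * (1 - x j) = 0"
      using ij fin t3 by (subst (asm) sum_nonneg_eq_0_iff) auto
    then show "c i j = 0 \<or> x j = 1" by auto
  qed
  moreover have ?D
  proof -
    have "(\<Sum>i\<in>I. (\<Sum>j\<in>I. c i j * x j) - r * x i) = 0" using z(4) pos by simp
    then show ?thesis using fin t4 by (subst (asm) sum_nonneg_eq_0_iff) auto
  qed
  ultimately show "?A \<and> ?B \<and> ?C \<and> ?D" by blast
qed

text \<open>The set is \<open>S = {i\<in>I. x i = 1}\<close>. Any of its members can play the role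
  of \<open>s\<close>, so what equality says about a single row holds for every row in
  \<open>S\<close>.\<close>

lemma subinvariant_extremal_structure:
  fixes c :: "'i \<Rightarrow> 'i \<Rightarrow> real"
  assumes fin: "finite I" and s: "s \<in> I" "x s = 1"
    and c0: "\<And>i j. i \<in> I \<Longrightarrow> j \<in> I \<Longrightarrow> 0 \<le> c i j"
    and cd: "\<And>i. i \<in> I \<Longrightarrow> c i i \<le> d"
    and cf: "\<And>i j. i \<in> I \<Longrightarrow> j \<in> I \<Longrightarrow> i \<noteq> j \<Longrightarrow> c i j \<le> f"
    and x: "\<And>i. i \<in> I \<Longrightarrow> 0 \<le> x i" "\<And>i. i \<in> I \<Longrightarrow> x i \<le> 1"
    and sub: "\<And>i. i \<in> I \<Longrightarrow> r * x i \<le> (\<Sum>j\<in>I. c i j * x j)"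
    and "0 < f" "0 < r"
    and eq: "r\<^sup>2 = (d - f) * r + f * (\<Sum>i\<in>I. \<Sum>j\<in>I. c i j)"
  obtains S where "S \<subseteq> I"
    "\<And>i j. i \<in> I \<Longrightarrow> j \<in> I \<Longrightarrow> c i j = (if i \<in> S \<and> j \<in> S then if i = j then d else f else 0)"
proof
  define S where "S = {i\<in>I. x i = 1}"
  have str: "c t t = d \<and> (\<forall>j\<in>I - {t}. c t j = f \<or> x j = 0) \<and>
      (\<forall>i\<in>I. \<forall>j\<in>I. c i j = 0 \<or> x j = 1) \<and>
      (\<forall>i\<in>I. r * x i = (\<Sum>j\<in>I. c i j * x j))" if "t \<in> S" for t
    using that assms unfolding S_def
    by (intro subinvariant_quadratic_bound(2)) auto
  have "s \<in> S" using s by (simp add: S_def)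
  have x0: "x j = 0" if "j \<in> I" "j \<notin> S" for j
  proof -
    have "x j \<noteq> 1" "j \<noteq> s" using that \<open>s \<in> S\<close> by (auto simp: S_def)
    \<comment> \<open>If \<open>x j\<close> is not 1, then column \<open>j\<close> vanishes; hence
      \<open>c s j\<close> cannot be \<open>f\<close>, and only \<open>x j = 0\<close> remains. Thus
      \<open>x\<close> takes just the values 0 and 1.\<close>
    then have "c s j = 0" "c s j = f \<or> x j = 0" using str[OF \<open>s \<in> S\<close>] that s by blast+
    then show ?thesis using \<open>0 < f\<close> by simp
  qed
  have row0: "c i j = 0" if "i \<in> I" "i \<notin> S" "j \<in> S" for i j
  proof -
    \<comment> \<open>Subinvariance is now an equality, and \<open>x i = 0\<close> outside
      \<open>S\<close>, so a sum of nonnegative terms is zero.\<close>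
    have "(\<Sum>j\<in>I. c i j * x j) = 0" using str[OF \<open>s \<in> S\<close>] x0 that by auto
    moreover have "\<And>j. j \<in> I \<Longrightarrow> 0 \<le> c i j * x j" using c0 x(1) that by simp
    ultimately have "c i j * x j = 0"
      using fin that unfolding S_def by (subst (asm) sum_nonneg_eq_0_iff) auto
    then show ?thesis using that by (simp add: S_def)
  qed
  show "S \<subseteq> I" by (auto simp: S_def)
  fix i j assume ij: "i \<in> I" "j \<in> I"
  consider "j \<notin> S" | "j \<in> S" "i \<notin> S" | "i \<in> S" "i = j" | "i \<in> S" "j \<in> S" "i \<noteq> j" by blast
  then show "c i j = (if i \<in> S \<and> j \<in> S then if i = j then d else f else 0)"
  proof cases
    case 1
    then show ?thesis using str[OF \<open>s \<in> S\<close>] ij by (auto simp: S_def)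
  next
    case 2
    then show ?thesis using row0 ij by simp
  next
    case 3
    then show ?thesis using str by simp
  next
    case 4
    then have "x j = 1" by (simp add: S_def)
    then show ?thesis using 4 str[OF 4(1)] ij by auto
  qed
qed

section \<open>Relabelling of indices and entrywise forms\<close>

text \<open>Moves the support \<open>S\<close> to the leading indices: a bijection onto
  \<open>S\<close> is glued to one onto its complement, using that the cardinalities agree.\<close>

lemma exists_permutes_image_lessThan:
  assumes "S \<subseteq> {..<n}"
  obtains p where "p permutes {..<n}" "\<And>i. i < n \<Longrightarrow> p i \<in> S \<longleftrightarrow> i < card S"
proof -
  have fin: "finite S" using assms finite_subset by blast
  have le: "card S \<le> n" using card_mono[OF _ assms] by simp
  obtain g where g: "bij_betw g {..<card S} S"
    using fin ex_bij_betw_nat_finite[of S] by (auto simp: atLeast0LessThan)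
  obtain h where h: "bij_betw h {card S..<n} ({..<n} - S)"
    using finite_same_card_bij[of "{card S..<n}" "{..<n} - S"] assms fin
    by (auto simp: card_Diff_subset)
  \<comment> \<open>The last branch fixes everything from \<open>n\<close> on, as
    \<open>permutes\<close> demands.\<close>
  define p where "p i = (if i < card S then g i else if i < n then h i else i)" for i
  have bg: "bij_betw p {..<card S} S"
    using g by (subst bij_betw_cong[of _ _ g]) (auto simp: p_def)
  have bh: "bij_betw p {card S..<n} ({..<n} - S)"
    using h by (subst bij_betw_cong[of _ _ h]) (auto simp: p_def)
  have "bij_betw p ({..<card S} \<union> {card S..<n}) (S \<union> ({..<n} - S))"
    by (rule bij_betw_combine[OF bg bh]) auto
  moreover have "{..<card S} \<union> {card S..<n} = {..<n}" "S \<union> ({..<n} - S) = {..<n}"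
    using le assms by auto
  ultimately have "p permutes {..<n}"
    using le by (intro bij_imp_permutes) (auto simp: p_def)
  moreover have "p i \<in> S \<longleftrightarrow> i < card S" if "i < n" for i
    using bij_betwE[OF bg] bij_betwE[OF bh] that by (cases "i < card S") auto
  ultimately show thesis using that by blast
qed

text \<open>Row \<open>i\<close> of \<open>P\<close> is the unit vector at \<open>p i\<close>, so
  each of the two products collapses to a single summand.\<close>

lemma permutation_mat_conj:
  fixes C :: "'a :: semiring_1 mat"
  assumes C: "C \<in> carrier_mat n n" and p: "p permutes {..<n}"
    and P: "P = mat n n (\<lambda>(i, j). if j = p i then 1 else 0)"
  shows "P * C * transpose_mat P = mat n n (\<lambda>(i, j). C $$ (p i, p j))"
proof (rule eq_matI)
  show "dim_row (P * C * transpose_mat P) = dim_row (mat n n (\<lambda>(i, j). C $$ (p i, p j)))"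
    "dim_col (P * C * transpose_mat P) = dim_col (mat n n (\<lambda>(i, j). C $$ (p i, p j)))"
    by (auto simp: P)
  fix i j assume "i < dim_row (mat n n (\<lambda>(i, j). C $$ (p i, p j)))"
    "j < dim_col (mat n n (\<lambda>(i, j). C $$ (p i, p j)))"
  then have ij: "i < n" "j < n" by auto
  have pn: "p i < n" if "i < n" for i using permutes_in_image[OF p, of i] that by simp
  have PC: "(P * C) $$ (i, l) = C $$ (p i, l)" if "l < n" for l
    using that ij pn[OF ij(1)] C
    by (simp add: P times_mat_def scalar_prod_def if_distrib[of "\<lambda>u. u * _"] sum.delta cong: if_cong)
  have "(P * C * transpose_mat P) $$ (i, j) = (\<Sum>l = 0..<n. (P * C) $$ (i, l) * P $$ (j, l))"
    using ij C by (simp add: P scalar_prod_def)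
  also have "\<dots> = C $$ (p i, p j)"
    using ij pn[OF ij(2)] PC
    by (simp add: P if_distrib[of "\<lambda>u. _ * u"] sum.delta cong: if_cong)
  finally show "(P * C * transpose_mat P) $$ (i, j) = mat n n (\<lambda>(i, j). C $$ (p i, p j)) $$ (i, j)"
    using ij by simp
qed

lemma sum_mat_square:
  assumes "C \<in> carrier_mat n n"
  shows "sum_mat C = (\<Sum>i<n. \<Sum>j<n. C $$ (i, j))"
  using assms by (simp add: sum_mat_def sum.cartesian_product atLeast0LessThan)

section \<open>Spectral radius of real matrices\<close>

text \<open>The triangle inequality, applied to each row of the complex eigenvalue equation, leaves
  an inequality between moduli because \<open>C\<close> is nonnegative.\<close>

lemma spectral_radius_subinvariant:
  assumes C: "C \<in> carrier_mat n n" and n: "0 < n"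
    and c0: "\<And>i j. i < n \<Longrightarrow> j < n \<Longrightarrow> 0 \<le> C $$ (i, j)"
  obtains x s where "s < n" "x s = 1" "\<And>i. i < n \<Longrightarrow> 0 \<le> x i" "\<And>i. i < n \<Longrightarrow> x i \<le> 1"
    "\<And>i. i < n \<Longrightarrow> real_spectral_radius C * x i \<le> (\<Sum>j<n. C $$ (i, j) * x j)"
proof -
  let ?M = "map_mat complex_of_real C"
  have M: "?M \<in> carrier_mat n n" using C by simp
  obtain l where l: "eigenvalue ?M l" and r: "real_spectral_radius C = norm l"
    using spectral_radius_mem_max(1)[OF M n]
    by (auto simp: spectrum_def real_spectral_radius_def)
  then obtain v where v: "v \<in> carrier_vec n" "v \<noteq> 0\<^sub>v n" "?M *\<^sub>v v = l \<cdot>\<^sub>v v"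
    using C by (auto simp: eigenvalue_def eigenvector_def)
  define y where "y i = norm (v $ i)" for i
  obtain s where s: "s < n" "\<And>i. i < n \<Longrightarrow> y i \<le> y s"
  proof -
    have fin: "finite (y ` {..<n})" and ne: "y ` {..<n} \<noteq> {}" using n by auto
    obtain s where "s < n" "Max (y ` {..<n}) = y s" using Max_in[OF fin ne] by auto
    then show thesis using that Max_ge[OF fin] by auto
  qed
  \<comment> \<open>A nonzero entry makes the largest modulus \<open>y s\<close> positive, which
    allows the division by it.\<close>
  obtain i where "i < n" "v $ i \<noteq> 0"
    using v by (metis carrier_vecD eq_vecI index_zero_vec)
  then have "0 < y i" "y i \<le> y s" using s(2) by (simp_all add: y_def)
  then have ys: "0 < y s" by simp
  have sub: "norm l * y i \<le> (\<Sum>j<n. C $$ (i, j) * y j)" if i: "i < n" for i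
  proof -
    have "l * v $ i = (\<Sum>j<n. complex_of_real (C $$ (i, j)) * v $ j)"
      using arg_cong[OF v(3), of "\<lambda>w. w $ i"] i v(1) C
      by (simp add: scalar_prod_def atLeast0LessThan)
    then have "norm l * y i = norm (\<Sum>j<n. complex_of_real (C $$ (i, j)) * v $ j)"
      by (simp add: y_def flip: norm_mult)
    also have "\<dots> \<le> (\<Sum>j<n. norm (complex_of_real (C $$ (i, j)) * v $ j))"
      by (rule norm_sum)
    also have "\<dots> = (\<Sum>j<n. C $$ (i, j) * y j)"
      using c0 i by (intro sum.cong) (auto simp: y_def norm_mult)
    finally show ?thesis .
  qed
  show thesis
  proof (rule that[of s "\<lambda>i. y i / y s"])
    fix i assume i: "i < n"
    show "y i / y s \<le> 1" using s(2)[OF i] ys by simp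
    show "0 \<le> y i / y s" using ys by (simp add: y_def)
    show "real_spectral_radius C * (y i / y s) \<le> (\<Sum>j<n. C $$ (i, j) * (y j / y s))"
      using divide_right_mono[OF sub[OF i], of "y s"] ys r by (simp add: sum_divide_distrib)
  qed (use s ys in auto)
qed

text \<open>A real eigenvector is also a complex one. This supplies the lower bounds on the spectral
  radius, in the one-by-one case and in the converse of the equality case.\<close>

lemma real_eigenvalue_le_spectral_radius:
  assumes C: "C \<in> carrier_mat n n" and k: "k < n" "x k \<noteq> 0"
    and ev: "\<And>i. i < n \<Longrightarrow> (\<Sum>j<n. C $$ (i, j) * x j) = l * x i"
  shows "l \<le> real_spectral_radius C"
proof -
  let ?M = "map_mat complex_of_real C" and ?v = "vec n (\<lambda>i. complex_of_real (x i))"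
  have M: "?M \<in> carrier_mat n n" using C by simp
  have "?M *\<^sub>v ?v = complex_of_real l \<cdot>\<^sub>v ?v"
    using C by (intro eq_vecI)
      (auto simp: scalar_prod_def atLeast0LessThan simp flip: of_real_mult of_real_sum ev)
  moreover have "?v \<noteq> 0\<^sub>v n"
    using k by (metis index_vec index_zero_vec(1) of_real_eq_0_iff)
  ultimately have "complex_of_real l \<in> spectrum ?M"
    using C by (auto simp: spectrum_def eigenvalue_def eigenvector_def intro!: exI[of _ ?v])
  then have "norm (complex_of_real l) \<le> spectral_radius ?M"
    using k by (intro spectral_radius_mem_max(2)[OF M] imageI) auto
  then show ?thesis by (simp add: real_spectral_radius_def)
qed

lemma real_spectral_radius_nonneg:
  assumes "C \<in> carrier_mat n n" "0 < n"
  shows "0 \<le> real_spectral_radius C"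
  using spectral_radius_mem_max(1)[of "map_mat complex_of_real C" n] assms
  by (auto simp: real_spectral_radius_def)

section \<open>Roots of the quadratic\<close>

text \<open>Completing the square; the comparison with the square root is valid for either sign of
  \<open>2 * r - b\<close>.\<close>

lemma quadratic_le_imp_le_root:
  fixes r :: real
  assumes "r\<^sup>2 \<le> b * r + q"
  shows "r \<le> (b + sqrt (b\<^sup>2 + 4 * q)) / 2"
proof -
  have "(2 * r - b)\<^sup>2 \<le> b\<^sup>2 + 4 * q"
    using assms by (simp add: power2_eq_square algebra_simps)
  then have "2 * r - b \<le> sqrt (b\<^sup>2 + 4 * q)" by (rule real_le_rsqrt)
  then show ?thesis by simp
qed

text \<open>The product of the two roots is \<open>- q < 0\<close>, so a nonnegative root can only
  be the larger one.\<close>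

lemma pos_quadratic_root_iff:
  fixes r :: real
  assumes "0 \<le> r" "0 < q"
  shows "r = (b + sqrt (b\<^sup>2 + 4 * q)) / 2 \<longleftrightarrow> r\<^sup>2 = b * r + q"
proof
  assume "r = (b + sqrt (b\<^sup>2 + 4 * q)) / 2"
  then have "2 * r - b = sqrt (b\<^sup>2 + 4 * q)" by simp
  then have "(2 * r - b)\<^sup>2 = b\<^sup>2 + 4 * q" using assms by simp
  then show "r\<^sup>2 = b * r + q" by (simp add: power2_eq_square algebra_simps)
next
  assume eq: "r\<^sup>2 = b * r + q"
  \<comment> \<open>Here \<open>r * (r - b) = q > 0\<close> gives \<open>b < r\<close>, hence
    \<open>2 * r - b > 0\<close>, which selects the positive square root.\<close>
  then have "0 < r * r - b * r" and "r \<noteq> 0" using assms by (auto simp: power2_eq_square)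
  then have "b < r" using assms by (auto simp flip: left_diff_distrib simp: zero_less_mult_iff)
  moreover have "(2 * r - b)\<^sup>2 = b\<^sup>2 + 4 * q"
    using eq by (simp add: power2_eq_square algebra_simps)
  ultimately have "sqrt (b\<^sup>2 + 4 * q) = 2 * r - b"
    using assms by (intro real_sqrt_unique) auto
  then show "r = (b + sqrt (b\<^sup>2 + 4 * q)) / 2" by simp
qed

section \<open>The extremal block matrix\<close>

lemma block_form_eq_mat:
  assumes "k \<le> n"
  shows "four_block_mat
      (f \<cdot>\<^sub>m all_ones_mat k + (d - f) \<cdot>\<^sub>m 1\<^sub>m k) (0\<^sub>m k (n - k))
      (0\<^sub>m (n - k) k) (0\<^sub>m (n - k) (n - k)) =
    mat n n (\<lambda>(i, j). if i < k \<and> j < k then if i = j then d else f else 0)"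
  using assms by (intro eq_matI) (auto simp: all_ones_mat_def)

text \<open>The row sum is the same throughout the block. It yields both the total of the entries
  and the eigenvalue belonging to the indicator vector of the block.\<close>

lemma sum_block_form_row:
  fixes d f :: real
  assumes "k \<le> n" "i < n"
  shows "(\<Sum>j<n. if i < k \<and> j < k then if i = j then d else f else 0) =
    (if i < k then (real k - 1) * f + d else 0)"
proof (cases "i < k")
  case True
  have "(\<Sum>j<n. if i < k \<and> j < k then if i = j then d else f else 0) =
      (\<Sum>j<k. if i = j then d else f)"
    using True assms by (intro sum.mono_neutral_cong_right) auto
  also have "\<dots> = d + (\<Sum>j\<in>{..<k} - {i}. f)"
    using True by (subst sum.remove[of _ i]) (auto intro!: sum.cong)
  also have "\<dots> = (real k - 1) * f + d"
    using True by (simp add: of_nat_diff)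
  finally show ?thesis using True by simp
qed simp

lemma sum_block_form:
  fixes d f :: real
  assumes "k \<le> n"
  shows "(\<Sum>i<n. \<Sum>j<n. if i < k \<and> j < k then if i = j then d else f else 0) =
    real k * (real k - 1) * f + real k * d"
proof -
  have "(\<Sum>i<n. \<Sum>j<n. if i < k \<and> j < k then if i = j then d else f else 0) =
      (\<Sum>i<n. if i < k then (real k - 1) * f + d else 0)"
    using assms by (intro sum.cong sum_block_form_row) auto
  also have "\<dots> = (\<Sum>i<k. (real k - 1) * f + d)"
    using assms by (intro sum.mono_neutral_cong_right) auto
  finally show ?thesis by (simp add: algebra_simps)
qed

section \<open>The bound and its equality case\<close>

theorem theorem7p2:
  fixes C :: "real mat" and n :: nat and m d f :: real
  assumes "n \<ge> 1"
    and "C \<in> carrier_mat n n"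
    and "\<forall>i<n. \<forall>j<n. 0 \<le> C $$ (i, j)"
    and "m = sum_mat C"
    and "\<forall>i<n. C $$ (i, i) \<le> d"
    and "\<forall>i<n. \<forall>j<n. i \<noteq> j \<longrightarrow> C $$ (i, j) \<le> f"
  shows "real_spectral_radius C \<le> (d - f + sqrt ((d - f)\<^sup>2 + 4 * m * f)) / 2 \<and>
    (m * f > 0 \<longrightarrow>
      (real_spectral_radius C = (d - f + sqrt ((d - f)\<^sup>2 + 4 * m * f)) / 2 \<longleftrightarrow>
        (\<exists>P k. permutation_matrix n P \<and> k \<le> n \<and>
          m = real k * (real k - 1) * f + real k * d \<and>
          P * C * transpose_mat P =
            four_block_mat
              (f \<cdot>\<^sub>m all_ones_mat k + (d - f) \<cdot>\<^sub>m 1\<^sub>m k) (0\<^sub>m k (n - k))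
              (0\<^sub>m (n - k) k) (0\<^sub>m (n - k) (n - k)))))"
proof -
  let ?r = "real_spectral_radius C"
  have n: "0 < n" using assms(1) by simp
  note C = assms(2)
  have m: "m = (\<Sum>i<n. \<Sum>j<n. C $$ (i, j))"
    using assms(4) sum_mat_square[OF C] by simp
  have m0: "0 \<le> m" unfolding m using assms(3) by (intro sum_nonneg) auto
  have r0: "0 \<le> ?r" by (rule real_spectral_radius_nonneg[OF C n])
  have c0: "\<And>i j. i < n \<Longrightarrow> j < n \<Longrightarrow> 0 \<le> C $$ (i, j)" using assms(3) by blast
  obtain x s where s: "s < n" "x s = 1" and x: "\<And>i. i < n \<Longrightarrow> 0 \<le> x i" "\<And>i. i < n \<Longrightarrow> x i \<le> 1"
    and sub: "\<And>i. i < n \<Longrightarrow> ?r * x i \<le> (\<Sum>j<n. C $$ (i, j) * x j)"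
    using spectral_radius_subinvariant[OF C n c0] by metis
  have quad: "?r\<^sup>2 \<le> (d - f) * ?r + m * f"
  proof (cases "0 \<le> f")
    case True
    have "?r\<^sup>2 \<le> (d - f) * ?r + f * (\<Sum>i<n. \<Sum>j<n. C $$ (i, j))"
      using s x sub r0 True assms(3,5,6) by (intro subinvariant_quadratic_bound(1)[of _ s x]) auto
    then show ?thesis by (simp add: m mult.commute)
  next
    case False
    \<comment> \<open>Any off-diagonal entry would lie between 0 and \<open>f\<close>, so a negative
      \<open>f\<close> is possible only when there is none.\<close>
    have "n = 1"
    proof (rule ccontr)
      assume "n \<noteq> 1"
      then have "1 < n" using n by simp
      then have "0 \<le> C $$ (0, 1)" "C $$ (0, 1) \<le> f" using c0 assms(6) by auto
      then show False using False by simp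
    qed
    have "?r \<le> C $$ (0, 0)" using sub[of 0] s \<open>n = 1\<close> by simp
    moreover have "C $$ (0, 0) \<le> ?r"
      using \<open>n = 1\<close> by (intro real_eigenvalue_le_spectral_radius[OF C, of 0 "\<lambda>_. 1"]) auto
    ultimately have r: "?r = C $$ (0, 0)" by simp
    \<comment> \<open>Since \<open>m = ?r\<close> here, the terms with \<open>f\<close> cancel and
      only this inequality is left of the goal.\<close>
    have "?r * ?r \<le> d * ?r" using r r0 assms(5) n by (intro mult_right_mono) auto
    then show ?thesis using r \<open>n = 1\<close> by (simp add: m power2_eq_square algebra_simps)
  qed
  have bound: "?r \<le> (d - f + sqrt ((d - f)\<^sup>2 + 4 * m * f)) / 2"
    using quadratic_le_imp_le_root[OF quad] by (simp add: mult.assoc)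
  moreover have "?r = (d - f + sqrt ((d - f)\<^sup>2 + 4 * m * f)) / 2 \<longleftrightarrow>
        (\<exists>P k. permutation_matrix n P \<and> k \<le> n \<and>
          m = real k * (real k - 1) * f + real k * d \<and>
          P * C * transpose_mat P =
            four_block_mat
              (f \<cdot>\<^sub>m all_ones_mat k + (d - f) \<cdot>\<^sub>m 1\<^sub>m k) (0\<^sub>m k (n - k))
              (0\<^sub>m (n - k) k) (0\<^sub>m (n - k) (n - k)))"
    (is "?eq \<longleftrightarrow> (\<exists>P k. ?form P k)") if mf: "m * f > 0"
  proof
    have f: "0 < f" and m1: "0 < m" using mf m0 by (auto simp: zero_less_mult_iff)
    assume ?eq
    then have eq: "?r\<^sup>2 = (d - f) * ?r + m * f"
      using pos_quadratic_root_iff[OF r0 mf, of "d - f"] by (simp add: mult.assoc)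
    have "?r \<noteq> 0"
    proof
      assume "?r = 0"
      with eq have "m * f = 0" by simp
      with mf show False by simp
    qed
    obtain S where S: "S \<subseteq> {..<n}" and CS: "\<And>i j. i < n \<Longrightarrow> j < n \<Longrightarrow>
        C $$ (i, j) = (if i \<in> S \<and> j \<in> S then if i = j then d else f else 0)"
    proof (rule subinvariant_extremal_structure
        [of "{..<n}" s x "\<lambda>i j. C $$ (i, j)" d f ?r])
      show "?r\<^sup>2 = (d - f) * ?r + f * (\<Sum>i<n. \<Sum>j<n. C $$ (i, j))"
        using eq by (simp add: m mult.commute)
    qed (use s x sub r0 f \<open>?r \<noteq> 0\<close> assms(3,5,6) in auto)
    obtain p where p: "p permutes {..<n}" and pS: "\<And>i. i < n \<Longrightarrow> p i \<in> S \<longleftrightarrow> i < card S"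
      using exists_permutes_image_lessThan[OF S] by blast
    define P :: "real mat" where "P = mat n n (\<lambda>(i, j). if j = p i then 1 else 0)"
    have k: "card S \<le> n" using card_mono[OF _ S] by simp
    have pn: "p i < n" if "i < n" for i using permutes_in_image[OF p, of i] that by simp
    have Cp: "C $$ (p i, p j) = (if i < card S \<and> j < card S then if i = j then d else f else 0)"
      if "i < n" "j < n" for i j
      using that CS pn pS permutes_inj[OF p] by (auto simp: inj_eq)
    \<comment> \<open>Permuting both indices preserves the total, which can then be read off the
      block form.\<close>
    have "m = (\<Sum>i<n. \<Sum>j<n. C $$ (p i, p j))"
      unfolding m by (subst (1 2) sum.permute[OF p]) (simp add: comp_def)
    also have "\<dots> = real (card S) * (real (card S) - 1) * f + real (card S) * d"
      using Cp sum_block_form[OF k, of d f] by simp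
    finally have "?form P (card S)"
      using p k Cp unfolding permutation_mat_conj[OF C p P_def] block_form_eq_mat[OF k]
      by (auto simp: permutation_matrix_def P_def intro!: cong_mat)
    then show "\<exists>P k. ?form P k" by blast
  next
    assume "\<exists>P k. ?form P k"
    then obtain P k where form: "?form P k" by blast
    then obtain p where p: "p permutes {..<n}"
      and P: "P = mat n n (\<lambda>(i, j). if j = p i then 1 else 0)"
      by (auto simp: permutation_matrix_def)
    have k: "k \<le> n" and mk: "m = real k * (real k - 1) * f + real k * d" using form by auto
    have pn: "p i < n" if "i < n" for i using permutes_in_image[OF p, of i] that by simp
    have Cp: "C $$ (p i, p j) = (if i < k \<and> j < k then if i = j then d else f else 0)"
      if "i < n" "j < n" for i j
    proof -
      have "C $$ (p i, p j) = (P * C * transpose_mat P) $$ (i, j)"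
        using permutation_mat_conj[OF C p P] that by simp
      then show ?thesis using form block_form_eq_mat[OF k, of f d] that by simp
    qed
    \<comment> \<open>The common row sum of the block; it will be shown to be an eigenvalue of
      \<open>C\<close> equal to the bound.\<close>
    define l where "l = (real k - 1) * f + d"
    have ml: "m = real k * l" by (simp add: mk l_def algebra_simps)
    have "k \<noteq> 0" using ml mf by (intro notI) simp
    have "0 < m" using mf m0 by (auto simp: zero_less_mult_iff)
    then have "0 < l" using ml by (simp add: zero_less_mult_iff)
    \<comment> \<open>Multiply \<open>l = (d - f) + k * f\<close> by \<open>l\<close> and use
      \<open>m = k * l\<close>.\<close>
    have "l\<^sup>2 = (d - f) * l + m * f"
      by (simp add: ml) (simp add: l_def power2_eq_square algebra_simps)
    then have l: "l = (d - f + sqrt ((d - f)\<^sup>2 + 4 * m * f)) / 2"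
      using pos_quadratic_root_iff[of l "m * f" "d - f"] \<open>0 < l\<close> mf by (simp add: mult.assoc)
    \<comment> \<open>The indicator vector of the block, carried back to the original indices of
      \<open>C\<close>; the inverse of \<open>p\<close> makes \<open>y (p i)\<close> depend only on
      \<open>i < k\<close>.\<close>
    define y :: "nat \<Rightarrow> real" where "y i = (if inv_into UNIV p i < k then 1 else 0)" for i
    have yp: "y (p i) = (if i < k then 1 else 0)" for i
      using permutes_inverses(2)[OF p] by (simp add: y_def)
    \<comment> \<open>The upper bound is already known, so only this direction remains. As
      \<open>k\<close> is nonzero, index \<open>p 0\<close> lies in the block and shows that
      \<open>y\<close> is not the zero vector.\<close>
    have "l \<le> ?r"
    proof (rule real_eigenvalue_le_spectral_radius[OF C, of "p 0" y])
      show "p 0 < n" "y (p 0) \<noteq> 0" using pn n \<open>k \<noteq> 0\<close> yp by auto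
      fix i assume "i < n"
      then obtain i' where i': "i' < n" "i = p i'"
        using permutes_image[OF p] by (metis imageE lessThan_iff)
      have "(\<Sum>j<n. C $$ (i, j) * y j) = (\<Sum>j<n. C $$ (i, p j) * y (p j))"
        using sum.permute[OF p, of "\<lambda>j. C $$ (i, j) * y j"] by (simp add: comp_def)
      also have "\<dots> = (\<Sum>j<n. if i' < k \<and> j < k then if i' = j then d else f else 0)"
        using i' Cp yp by (intro sum.cong) auto
      also have "\<dots> = l * y i"
        using sum_block_form_row[OF k i'(1), of d f] i' yp by (simp add: l_def)
      finally show "(\<Sum>j<n. C $$ (i, j) * y j) = l * y i" .
    qed
    then show ?eq using bound l by linarith
  qed
  ultimately show ?thesis by blast
qed

end
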